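(* Let $\mathscr{H}$ be a complex Hilbert space, let $T\in \mathbb{B}(\mathscr{H})$ and $\varepsilon\in[0, 1)$. The following statements are equivalent: (i) $T\parallel^{\varepsilon} I$; (ii) $\sup\{\|T\xi-(T\xi\mid \xi)\xi\|:\, \xi\in\mathscr{H},\ \|\xi\|=1\}\leq\varepsilon\|T\|$; (iii) $\sup\{\|T\xi\|^2-|(T\xi\mid \xi)|^2:\, \xi\in\mathscr{H},\ \|\xi\|=1\}\leq\varepsilon^2\|T\|^2$; (iv) $\|\delta_T\|\leq2\varepsilon\|T\|$.
   Context: $\mathbb{B}(\mathscr{H})$ is the $C^*$-algebra of bounded linear operators on $\mathscr{H}$ with the operator norm; $I$ is the identity operator; $(\cdot\mid\cdot)$ is the inner product of $\mathscr{H}$, linear in the first variable. For $T\in\mathbb{B}(\mathscr{H})$, the inner derivation $\delta_T:\mathbb{B}(\mathscr{H})\to\mathbb{B}(\mathscr{H})$ is $\delta_T(S)=TS-ST$, and $\|\delta_T\|$ is its norm as a bounded linear operator on $\mathbb{B}(\mathscr{H})$. For elements $x,y$ of a complex normed space and $\varepsilon\in[0,1)$, $x\parallel^{\varepsilon} y$ means that $\inf\{\|x+\mu y\| :\, \mu\in\mathbb{C}\}\leq\varepsilon\|x\|$. *)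

theory Defs
  imports "HOL-Analysis.Analysis"
begin

class complex_vector = real_vector +
  fixes scaleC :: "complex \<Rightarrow> 'a \<Rightarrow> 'a" (infixr \<open>*\<^sub>C\<close> 75)
  assumes scaleC_add_right: "a *\<^sub>C (x + y) = a *\<^sub>C x + a *\<^sub>C y"
    and scaleC_add_left: "(a + b) *\<^sub>C x = a *\<^sub>C x + b *\<^sub>C x"
    and scaleC_scaleC: "a *\<^sub>C (b *\<^sub>C x) = (a * b) *\<^sub>C x"
    and scaleC_one: "1 *\<^sub>C x = x"
    and scaleR_scaleC: "r *\<^sub>R x = complex_of_real r *\<^sub>C x"

class complex_normed_vector = complex_vector + real_normed_vector +
  assumes norm_scaleC: "norm (a *\<^sub>C x) = cmod a * norm x"

text \<open>The inner product is linear in the first variable. The last axiom says both that it is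
  positive definite and that the norm (hence the topology) is the one induced by it.\<close>

class complex_inner = complex_normed_vector +
  fixes cinner :: "'a \<Rightarrow> 'a \<Rightarrow> complex"
  assumes cinner_add_left: "cinner (x + y) z = cinner x z + cinner y z"
    and cinner_scaleC_left: "cinner (a *\<^sub>C x) y = a * cinner x y"
    and cinner_commute: "cinner x y = cnj (cinner y x)"
    and cinner_self: "cinner x x = complex_of_real ((norm x)\<^sup>2)"

class chilbert_space = complex_inner + complete_space

text \<open>The library's \<^const>\<open>bounded_linear\<close> is only real-linear, so complex homogeneity is required separately.\<close>

typedef (overloaded) ('a, 'b) cblinfun (\<open>(_ \<Rightarrow>\<^sub>B /_)\<close> [22, 21] 21) =
  "{f :: 'a::complex_normed_vector \<Rightarrow> 'b::complex_normed_vector.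
      bounded_linear f \<and> (\<forall>c x. f (c *\<^sub>C x) = c *\<^sub>C f x)}"
  morphisms cblinfun_apply CBlinfun
proof -
  have "0 = c *\<^sub>C (0::'b)" for c
    using norm_scaleC[of c "0::'b"] by simp
  then show ?thesis
    by (intro exI[of _ "\<lambda>_. 0"]) simp
qed

declare [[coercion
    "cblinfun_apply :: ('a::complex_normed_vector \<Rightarrow>\<^sub>B 'b::complex_normed_vector) \<Rightarrow> 'a \<Rightarrow> 'b"]]

setup_lifting type_definition_cblinfun

lemma cblinfun_eqI: "(\<And>x. cblinfun_apply S x = cblinfun_apply T x) \<Longrightarrow> S = T"
  by transfer auto

lemma scaleC_zero_right: "a *\<^sub>C (0::'a::complex_vector) = 0"
  using scaleC_add_right[of a "0::'a" 0] by simp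

lemma scaleC_minus_right: "a *\<^sub>C (- x::'a::complex_vector) = - (a *\<^sub>C x)"
  using scaleC_add_right[of a x "- x"] by (simp add: scaleC_zero_right eq_neg_iff_add_eq_0 add.commute)

lemma scaleC_diff_right: "a *\<^sub>C (x - y::'a::complex_vector) = a *\<^sub>C x - a *\<^sub>C y"
  using scaleC_add_right[of a x "- y"] by (simp add: scaleC_minus_right)

lemma bounded_linear_scaleC_right:
  "bounded_linear (\<lambda>x::'a::complex_normed_vector. a *\<^sub>C x)"
  by (rule bounded_linear_intro[where K = "cmod a"])
     (simp_all add: scaleC_add_right scaleR_scaleC scaleC_scaleC norm_scaleC mult.commute)

lemma onorm_scaleC:
  fixes f :: "'a::real_normed_vector \<Rightarrow> 'b::complex_normed_vector"
  assumes "bounded_linear f"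
  shows "onorm (\<lambda>x. a *\<^sub>C f x) = cmod a * onorm f"
proof -
  have "onorm (\<lambda>x. a *\<^sub>C f x) = onorm (\<lambda>x. cmod a *\<^sub>R f x)"
    by (simp add: onorm_def norm_scaleC)
  then show ?thesis
    using onorm_scaleR[OF assms, of "cmod a"] by simp
qed

instantiation cblinfun :: (complex_normed_vector, complex_normed_vector) complex_normed_vector
begin

lift_definition norm_cblinfun :: "'a \<Rightarrow>\<^sub>B 'b \<Rightarrow> real" is onorm .

lift_definition zero_cblinfun :: "'a \<Rightarrow>\<^sub>B 'b" is "\<lambda>x. 0"
  by (simp add: scaleC_zero_right)

lift_definition plus_cblinfun :: "'a \<Rightarrow>\<^sub>B 'b \<Rightarrow> 'a \<Rightarrow>\<^sub>B 'b \<Rightarrow> 'a \<Rightarrow>\<^sub>B 'b" is "\<lambda>f g x. f x + g x"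
  by (simp add: bounded_linear_add scaleC_add_right)

lift_definition minus_cblinfun :: "'a \<Rightarrow>\<^sub>B 'b \<Rightarrow> 'a \<Rightarrow>\<^sub>B 'b \<Rightarrow> 'a \<Rightarrow>\<^sub>B 'b" is "\<lambda>f g x. f x - g x"
  by (simp add: bounded_linear_sub scaleC_diff_right)

lift_definition uminus_cblinfun :: "'a \<Rightarrow>\<^sub>B 'b \<Rightarrow> 'a \<Rightarrow>\<^sub>B 'b" is "\<lambda>f x. - f x"
  by (simp add: bounded_linear_minus scaleC_minus_right)

lift_definition scaleC_cblinfun :: "complex \<Rightarrow> 'a \<Rightarrow>\<^sub>B 'b \<Rightarrow> 'a \<Rightarrow>\<^sub>B 'b" is "\<lambda>a f x. a *\<^sub>C f x"
  by (simp add: bounded_linear_compose[OF bounded_linear_scaleC_right] scaleC_scaleC mult.commute)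

definition scaleR_cblinfun :: "real \<Rightarrow> 'a \<Rightarrow>\<^sub>B 'b \<Rightarrow> 'a \<Rightarrow>\<^sub>B 'b"
  where "scaleR_cblinfun r T = complex_of_real r *\<^sub>C T"

definition dist_cblinfun :: "'a \<Rightarrow>\<^sub>B 'b \<Rightarrow> 'a \<Rightarrow>\<^sub>B 'b \<Rightarrow> real"
  where "dist_cblinfun S T = norm (S - T)"

definition [code del]:
  "(uniformity :: (('a \<Rightarrow>\<^sub>B 'b) \<times> ('a \<Rightarrow>\<^sub>B 'b)) filter) = (INF e\<in>{0 <..}. principal {(x, y). dist x y < e})"

definition open_cblinfun :: "('a \<Rightarrow>\<^sub>B 'b) set \<Rightarrow> bool"
  where [code del]: "open_cblinfun S = (\<forall>x\<in>S. \<forall>\<^sub>F (x', y) in uniformity. x' = x \<longrightarrow> y \<in> S)"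

definition sgn_cblinfun :: "'a \<Rightarrow>\<^sub>B 'b \<Rightarrow> 'a \<Rightarrow>\<^sub>B 'b"
  where "sgn_cblinfun T = scaleR (inverse (norm T)) T"

instance
proof
  fix S T U :: "'a \<Rightarrow>\<^sub>B 'b" and a b :: complex and r s :: real
  show "S + T + U = S + (T + U)" "S + T = T + S" "0 + S = S" "- S + S = 0" "S - T = S + - T"
    by (transfer, simp add: algebra_simps)+
  show scaleC: "a *\<^sub>C (S + T) = a *\<^sub>C S + a *\<^sub>C T" "(a + b) *\<^sub>C S = a *\<^sub>C S + b *\<^sub>C S"
      "a *\<^sub>C (b *\<^sub>C S) = (a * b) *\<^sub>C S" "1 *\<^sub>C S = S" for a b and S T :: "'a \<Rightarrow>\<^sub>B 'b"
    by (transfer, simp add: scaleC_add_right scaleC_add_left scaleC_scaleC scaleC_one)+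
  show "r *\<^sub>R S = complex_of_real r *\<^sub>C S"
    by (rule scaleR_cblinfun_def)
  show "r *\<^sub>R (S + T) = r *\<^sub>R S + r *\<^sub>R T" "(r + s) *\<^sub>R S = r *\<^sub>R S + s *\<^sub>R S"
      "r *\<^sub>R s *\<^sub>R S = (r * s) *\<^sub>R S" "1 *\<^sub>R S = S"
    by (simp_all add: scaleR_cblinfun_def scaleC)
  show normC: "norm (a *\<^sub>C S) = cmod a * norm S" for a
    by transfer (simp add: onorm_scaleC)
  show "norm (r *\<^sub>R S) = \<bar>r\<bar> * norm S"
    by (simp add: scaleR_cblinfun_def normC)
  show "norm (S + T) \<le> norm S + norm T"
    by transfer (simp add: onorm_triangle)
  show "norm S = 0 \<longleftrightarrow> S = 0"
    by transfer (auto simp: onorm_eq_0)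
qed (rule dist_cblinfun_def uniformity_cblinfun_def open_cblinfun_def sgn_cblinfun_def)+

end

lemma norm_cblinfun: "norm (cblinfun_apply T x) \<le> norm T * norm x"
  by transfer (simp add: onorm)

lemma norm_cblinfun_bound:
  "0 \<le> b \<Longrightarrow> (\<And>x. norm (cblinfun_apply T x) \<le> b * norm x) \<Longrightarrow> norm T \<le> b"
  by transfer (simp add: onorm_bound)

lift_definition id_cblinfun :: "'a::complex_normed_vector \<Rightarrow>\<^sub>B 'a" is "\<lambda>x. x"
  by simp

lift_definition cblinfun_compose ::
  "'b::complex_normed_vector \<Rightarrow>\<^sub>B 'c::complex_normed_vector \<Rightarrow>
   'a::complex_normed_vector \<Rightarrow>\<^sub>B 'b \<Rightarrow> 'a \<Rightarrow>\<^sub>B 'c" (infixl \<open>o\<^sub>C\<close> 55)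
  is "\<lambda>f g x. f (g x)"
  by (simp add: bounded_linear_compose)

lemma cblinfun_apply_add: "cblinfun_apply T (x + y) = cblinfun_apply T x + cblinfun_apply T y"
  by transfer (simp add: bounded_linear.linear linear_add)

lemma cblinfun_apply_scaleC: "cblinfun_apply T (a *\<^sub>C x) = a *\<^sub>C cblinfun_apply T x"
  by transfer simp

lemma norm_cblinfun_compose: "norm (S o\<^sub>C T) \<le> norm S * norm T"
  by transfer (simp add: onorm_compose[unfolded comp_def])

lift_definition inner_derivation ::
  "'a::complex_normed_vector \<Rightarrow>\<^sub>B 'a \<Rightarrow> ('a \<Rightarrow>\<^sub>B 'a) \<Rightarrow>\<^sub>B ('a \<Rightarrow>\<^sub>B 'a)"
  is "\<lambda>T S. (T o\<^sub>C S) - (S o\<^sub>C T)"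
proof (intro conjI allI)
  fix T :: "'a \<Rightarrow>\<^sub>B 'a"
  have add: "(T o\<^sub>C (S + S')) - ((S + S') o\<^sub>C T) = ((T o\<^sub>C S) - (S o\<^sub>C T)) + ((T o\<^sub>C S') - (S' o\<^sub>C T))"
    for S S'
    by (rule cblinfun_eqI)
       (simp add: cblinfun_compose.rep_eq plus_cblinfun.rep_eq minus_cblinfun.rep_eq cblinfun_apply_add)
  show scale: "(T o\<^sub>C (c *\<^sub>C S)) - ((c *\<^sub>C S) o\<^sub>C T) = c *\<^sub>C ((T o\<^sub>C S) - (S o\<^sub>C T))" for c S
    by (rule cblinfun_eqI)
       (simp add: cblinfun_compose.rep_eq scaleC_cblinfun.rep_eq minus_cblinfun.rep_eq
          cblinfun_apply_scaleC scaleC_diff_right)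
  have bound: "norm ((T o\<^sub>C S) - (S o\<^sub>C T)) \<le> norm S * (2 * norm T)" for S
    using norm_triangle_ineq4[of "T o\<^sub>C S" "S o\<^sub>C T"]
      norm_cblinfun_compose[of T S] norm_cblinfun_compose[of S T]
    by (simp add: algebra_simps)
  show "bounded_linear (\<lambda>S. (T o\<^sub>C S) - (S o\<^sub>C T))"
    by (rule bounded_linear_intro[OF add _ bound]) (simp add: scaleR_scaleC scale)
qed

text \<open>The relation $x \parallel^{\varepsilon} y$. The infimum is over a nonempty set bounded below
  by 0.\<close>

definition approx_parallel :: "real \<Rightarrow> 'a::complex_normed_vector \<Rightarrow> 'a \<Rightarrow> bool"
  where "approx_parallel \<epsilon> x y \<longleftrightarrow> (INF \<mu>. norm (x + \<mu> *\<^sub>C y)) \<le> \<epsilon> * norm x"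

end

theory Submission
  imports Defs
begin

text \<open>
  Write \<open>d\<close> for the distance of \<open>T\<close> to the scalar operators and \<open>e \<xi> = T \<xi> - (T \<xi> | \<xi>) \<xi>\<close>
  for a unit vector \<open>\<xi>\<close>. By Pythagoras the squared norm of \<open>e \<xi>\<close> is \<open>\<parallel>T \<xi>\<parallel>\<^sup>2 - |(T \<xi> | \<xi>)|\<^sup>2\<close>,
  so the second and third conditions are the same one. All the conditions are then equivalent,
  for any nonnegative bound in the place of \<open>\<epsilon> \<parallel>T\<parallel>\<close>, because of
  \<open>\<parallel>\<delta>\<^sub>T\<parallel> \<le> 2 d\<close>, \<open>2 \<parallel>e \<xi>\<parallel> \<le> \<parallel>\<delta>\<^sub>T\<parallel>\<close> and \<open>d \<le> sup \<parallel>e \<xi>\<parallel>\<close>.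

  The first inequality holds because \<open>\<delta>\<^sub>T\<close> does not change when a scalar is added to \<open>T\<close>. The second
  comes from applying \<open>\<delta>\<^sub>T\<close> to the reflection in the hyperplane orthogonal to \<open>\<xi>\<close>, an operator of norm
  at most 1 whose commutator with \<open>T\<close> maps \<open>\<xi>\<close> to \<open>- 2 e \<xi>\<close>.

  The third inequality is the substance (lemma \<open>distance_to_scalars_le\<close>). Let \<open>A = T + \<mu> I\<close> have norm \<open>d\<close>,
  the least possible; \<open>e \<xi>\<close> is the same for \<open>A\<close> as for \<open>T\<close>. It is enough to find unit vectors
  \<open>\<xi>\<close> with \<open>\<parallel>A \<xi>\<parallel>\<close> close to \<open>d\<close> and \<open>(A \<xi> | \<xi>)\<close> close to 0. For \<open>m < d\<^sup>2\<close>, consider the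
  values \<open>(A \<xi> | \<xi>)\<close> over the unit vectors with \<open>\<parallel>A \<xi>\<parallel>\<^sup>2 \<ge> m\<close>. This set is convex.
  If 0 were not in its closure, a line would separate it strictly from 0, and a small scalar step perpendicular to this line would make the norm of \<open>A\<close> smaller: it reduces \<open>\<parallel>A \<xi>\<parallel>\<close>
  where that is large, and where \<open>\<parallel>A \<xi>\<parallel>\<^sup>2 < m\<close> there is room to spare.

  Convexity is a form of the Toeplitz-Hausdorff theorem with a side condition, and rests
  on lemma \<open>merge_vectors\<close>: two vectors can be replaced by a single one for which the quadratic forms
  \<open>\<parallel>z\<parallel>\<^sup>2\<close> and \<open>(A z | z)\<close> take the sums of the two values, and \<open>\<parallel>A z\<parallel>\<^sup>2\<close> at least the sum.
\<close>

section \<open>Complex inner products\<close>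

lemma cinner_add_right: "cinner x (y + z) = cinner x y + cinner (x::'a::complex_inner) z"
  by (metis cinner_add_left cinner_commute complex_cnj_add)

lemma cinner_scaleC_right: "cinner x (a *\<^sub>C y) = cnj a * cinner (x::'a::complex_inner) y"
  by (metis cinner_commute cinner_scaleC_left complex_cnj_mult)

lemma scaleC_minus1: "(-1) *\<^sub>C (x::'a::complex_vector) = - x"
  using scaleR_scaleC[of "-1" x] by simp

lemma norm_add_squared:
  "(norm (x + y))\<^sup>2 = (norm x)\<^sup>2 + 2 * Re (cinner x y) + (norm (y::'a::complex_inner))\<^sup>2"
proof -
  have "complex_of_real ((norm (x + y))\<^sup>2)
      = complex_of_real ((norm x)\<^sup>2) + (cinner x y + cnj (cinner x y)) + complex_of_real ((norm y)\<^sup>2)"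
    by (simp only: cinner_self[symmetric] cinner_add_left cinner_add_right cinner_commute[of y x]) simp
  then have "complex_of_real ((norm (x + y))\<^sup>2)
      = complex_of_real ((norm x)\<^sup>2 + 2 * Re (cinner x y) + (norm y)\<^sup>2)"
    by (simp add: complex_add_cnj)
  then show ?thesis
    using of_real_eq_iff by blast
qed

text \<open>Pythagoras: the residual splits into a part orthogonal to \<open>\<xi>\<close>, which does not depend on \<open>c\<close>, and a
  multiple of \<open>\<xi>\<close>. The choice of \<open>c\<close> gives the Cauchy-Schwarz inequality, the formula for
  \<open>\<parallel>e \<xi>\<parallel>\<^sup>2\<close>, and the isometry of reflections.\<close>
lemma norm_residual_squared:
  fixes x \<xi> :: "'a::complex_inner"
  assumes "norm \<xi> = 1"
  shows "(norm (x - c *\<^sub>C \<xi>))\<^sup>2 = ((norm x)\<^sup>2 - (cmod (cinner x \<xi>))\<^sup>2) + (cmod (cinner x \<xi> - c))\<^sup>2"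
proof -
  have "x - c *\<^sub>C \<xi> = x + (- c) *\<^sub>C \<xi>"
    using scaleC_add_left[of c "- c" \<xi>] scaleR_scaleC[of 0 \<xi>]
    by (simp add: algebra_simps eq_neg_iff_add_eq_0)
  then have "(norm (x - c *\<^sub>C \<xi>))\<^sup>2 = (norm x)\<^sup>2 - 2 * Re (cnj c * cinner x \<xi>) + (cmod c)\<^sup>2"
    by (simp only: norm_add_squared norm_scaleC assms cinner_scaleC_right) simp
  then show ?thesis
    by (simp add: cmod_power2) (simp add: power2_eq_square algebra_simps)
qed

lemma cmod_cinner_le_norm:
  fixes x \<xi> :: "'a::complex_inner"
  assumes "norm \<xi> = 1"
  shows "cmod (cinner x \<xi>) \<le> norm x"
proof -
  have "0 \<le> (norm x)\<^sup>2 - (cmod (cinner x \<xi>))\<^sup>2"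
    using norm_residual_squared[OF assms, of x "cinner x \<xi>"] zero_le_power2[of "norm (x - cinner x \<xi> *\<^sub>C \<xi>)"]
    by simp
  then show ?thesis
    by (metis diff_ge_0_iff_ge norm_ge_zero power2_le_imp_le)
qed

section \<open>Convexity of restricted numerical ranges\<close>

text \<open>The matrix with rows \<open>(a, p)\<close> and \<open>(q, -a)\<close> has trace zero, so some orthonormal basis of
  \<open>\<complex>\<^sup>2\<close> gives it a zero diagonal; the first diagonal entry is the equation, the second then vanishes
  with the trace. For the first basis vector \<open>(\<alpha>, \<beta>)\<close> the phase \<open>u\<close> of \<open>\<beta>\<close> is chosen
  so that the off-diagonal contribution is a real multiple \<open>t\<close> of \<open>a\<close>; what is left is a real
  quadratic equation for the ratio \<open>r\<close> of the moduli.\<close>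
lemma trace_zero_zero_diagonal:
  fixes a p q :: complex
  obtains \<alpha> \<beta> where "\<alpha> * cnj \<alpha> + \<beta> * cnj \<beta> = 1"
    and "a * (\<alpha> * cnj \<alpha> - \<beta> * cnj \<beta>) + \<alpha> * cnj \<beta> * p + \<beta> * cnj \<alpha> * q = 0"
proof (cases "a = 0")
  case True
  then show ?thesis
    using that[of 1 0] by simp
next
  case False
  \<comment> \<open>multiplication by u makes k real, which is what cancels the imaginary part below\<close>
  define k where "k = cnj a * q - a * cnj p"
  define u where "u = (if k = 0 then 1 else cnj k / cmod k)"
  have u: "u * cnj u = 1"
  proof (cases "k = 0")
    case True
    then show ?thesis
      by (simp add: u_def)
  next
    case False
    then have "u * cnj u = (k * cnj k) / (complex_of_real (cmod k) * complex_of_real (cmod k))"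
      by (simp add: u_def del: complex_mult_cnj)
    also have "\<dots> = 1"
      using False by (simp only: complex_norm_square[symmetric] power2_eq_square of_real_mult) simp
    finally show ?thesis .
  qed
  have "Im (u * k) = 0"
    by (auto simp: u_def mult.commute)
  then have im0: "Im (cnj a * (cnj u * p + u * q)) = 0"
    by (simp add: k_def algebra_simps)
  define t where "t = Re (cnj a * (cnj u * p + u * q)) / (cmod a)\<^sup>2"
  have "cnj a * (cnj u * p + u * q) = complex_of_real (Re (cnj a * (cnj u * p + u * q)))"
    using im0 by (simp add: complex_eq_iff)
  also have "\<dots> = complex_of_real t * complex_of_real ((cmod a)\<^sup>2)"
    using False by (simp add: t_def)
  also have "\<dots> = cnj a * (complex_of_real t * a)"
    by (simp only: complex_norm_square) simp
  finally have ta: "cnj u * p + u * q = complex_of_real t * a"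
    using False by simp
  define r where "r = (t + sqrt (t\<^sup>2 + 4)) / 2"
  have "(sqrt (t\<^sup>2 + 4))\<^sup>2 = t\<^sup>2 + 4"
    by simp
  then have r: "1 - r\<^sup>2 + t * r = 0"
    unfolding r_def by (simp add: power2_eq_square field_simps)
  define c where "c = 1 / sqrt (1 + r\<^sup>2)"
  have "0 < 1 + r\<^sup>2"
    by (simp add: add_pos_nonneg)
  then have c: "c\<^sup>2 * (1 + r\<^sup>2) = 1"
    by (simp add: c_def power_divide)
  define \<alpha> where "\<alpha> = complex_of_real c"
  define \<beta> where "\<beta> = u * complex_of_real (r * c)"
  have aa: "\<alpha> * cnj \<alpha> = complex_of_real (c\<^sup>2)"
    by (simp add: \<alpha>_def power2_eq_square)
  have "\<beta> * cnj \<beta> = (u * cnj u) * complex_of_real ((r * c)\<^sup>2)"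
    by (simp add: \<beta>_def power2_eq_square)
  then have bb: "\<beta> * cnj \<beta> = complex_of_real ((r * c)\<^sup>2)"
    by (simp only: u) simp
  have "\<alpha> * cnj \<beta> * p + \<beta> * cnj \<alpha> * q = complex_of_real (r * c\<^sup>2) * (cnj u * p + u * q)"
    by (simp add: \<alpha>_def \<beta>_def power2_eq_square algebra_simps)
  also have "\<dots> = a * complex_of_real (r * c\<^sup>2 * t)"
    by (simp add: ta)
  finally have off: "\<alpha> * cnj \<beta> * p + \<beta> * cnj \<alpha> * q = a * complex_of_real (r * c\<^sup>2 * t)" .
  have "c\<^sup>2 - (r * c)\<^sup>2 + r * c\<^sup>2 * t = c\<^sup>2 * (1 - r\<^sup>2 + t * r)"
    by (simp add: power2_eq_square algebra_simps)
  then have z: "c\<^sup>2 - (r * c)\<^sup>2 + r * c\<^sup>2 * t = 0"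
    by (simp add: r)
  show ?thesis
  proof (rule that)
    have "c\<^sup>2 + (r * c)\<^sup>2 = 1"
      using c by (simp add: power2_eq_square algebra_simps)
    then show "\<alpha> * cnj \<alpha> + \<beta> * cnj \<beta> = 1"
      unfolding aa bb by (metis of_real_1 of_real_add)
    have "a * (\<alpha> * cnj \<alpha> - \<beta> * cnj \<beta>) + (\<alpha> * cnj \<beta> * p + \<beta> * cnj \<alpha> * q)
        = a * complex_of_real (c\<^sup>2 - (r * c)\<^sup>2 + r * c\<^sup>2 * t)"
      unfolding aa bb off by (simp add: algebra_simps)
    then show "a * (\<alpha> * cnj \<alpha> - \<beta> * cnj \<beta>) + \<alpha> * cnj \<beta> * p + \<beta> * cnj \<alpha> * q = 0"
      by (simp add: z add.assoc)
  qed
qed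

text \<open>Mixing a pair of vectors by a unitary 2 by 2 matrix keeps the sum of any sesquilinear form
  over the pair. Two independent pairs are allowed because the form may be \<open>(A x | y)\<close>.\<close>
lemma cinner_unitary_mixing:
  fixes v w v' w' :: "'a::complex_inner"
  assumes "\<alpha> * cnj \<alpha> + \<beta> * cnj \<beta> = 1"
  shows "cinner (\<alpha> *\<^sub>C v + \<beta> *\<^sub>C w) (\<alpha> *\<^sub>C v' + \<beta> *\<^sub>C w')
       + cinner ((- cnj \<beta>) *\<^sub>C v + cnj \<alpha> *\<^sub>C w) ((- cnj \<beta>) *\<^sub>C v' + cnj \<alpha> *\<^sub>C w')
       = cinner v v' + cinner w w'"
proof -
  have "cinner (\<alpha> *\<^sub>C v + \<beta> *\<^sub>C w) (\<alpha> *\<^sub>C v' + \<beta> *\<^sub>C w')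
       + cinner ((- cnj \<beta>) *\<^sub>C v + cnj \<alpha> *\<^sub>C w) ((- cnj \<beta>) *\<^sub>C v' + cnj \<alpha> *\<^sub>C w')
      = (\<alpha> * cnj \<alpha> + \<beta> * cnj \<beta>) * (cinner v v' + cinner w w')"
    by (simp add: cinner_add_left cinner_add_right cinner_scaleC_left cinner_scaleC_right algebra_simps)
  then show ?thesis
    by (simp add: assms)
qed

lemma norm_unitary_mixing:
  fixes v w :: "'a::complex_inner"
  assumes "\<alpha> * cnj \<alpha> + \<beta> * cnj \<beta> = 1"
  shows "(norm (\<alpha> *\<^sub>C v + \<beta> *\<^sub>C w))\<^sup>2 + (norm ((- cnj \<beta>) *\<^sub>C v + cnj \<alpha> *\<^sub>C w))\<^sup>2
       = (norm v)\<^sup>2 + (norm w)\<^sup>2"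
proof -
  have "complex_of_real ((norm (\<alpha> *\<^sub>C v + \<beta> *\<^sub>C w))\<^sup>2 + (norm ((- cnj \<beta>) *\<^sub>C v + cnj \<alpha> *\<^sub>C w))\<^sup>2)
      = complex_of_real ((norm v)\<^sup>2 + (norm w)\<^sup>2)"
    using cinner_unitary_mixing[OF assms, of v w v w] by (simp only: cinner_self of_real_add)
  then show ?thesis
    using of_real_eq_iff by blast
qed

lemma cblinfun_apply_zero: "cblinfun_apply T 0 = 0"
  using cblinfun_apply_add[of T 0 0] by simp

text \<open>A unitary mixing of \<open>x\<close> and \<open>y\<close> preserves the three sums and can make the Rayleigh quotients
  \<open>(A v | v) / \<parallel>v\<parallel>\<^sup>2\<close> of the two new vectors equal. Then each of them that is not 0 has, after
  rescaling, the right values of \<open>\<parallel>z\<parallel>\<^sup>2\<close> and \<open>(A z | z)\<close>, and one has a ratio \<open>\<parallel>A v\<parallel>\<^sup>2 / \<parallel>v\<parallel>\<^sup>2\<close> that is at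
  least the average.\<close>
lemma merge_vectors:
  fixes A :: "'a::complex_inner \<Rightarrow>\<^sub>B 'a" and x y :: 'a
  obtains z where "(norm z)\<^sup>2 = (norm x)\<^sup>2 + (norm y)\<^sup>2"
    and "cinner (A z) z = cinner (A x) x + cinner (A y) y"
    and "(norm (A z))\<^sup>2 \<ge> (norm (A x))\<^sup>2 + (norm (A y))\<^sup>2"
proof (cases "x = 0 \<and> y = 0")
  case True
  then show ?thesis
    using that[of 0] by (simp add: cblinfun_apply_zero cinner_self)
next
  case False
  define H where "H = (norm x)\<^sup>2 + (norm y)\<^sup>2"
  define M where "M = (norm (A x))\<^sup>2 + (norm (A y))\<^sup>2"
  define W where "W = cinner (A x) x + cinner (A y) y"
  have H: "H > 0"
    using False by (auto simp: H_def sum_power2_gt_zero_iff)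
  \<comment> \<open>subtracting the mean quotient W / H gives the form w trace zero on the pair x, y\<close>
  define w where "w = (\<lambda>v v'. cinner (A v) v' - W / H * cinner v v')"
  obtain \<alpha> \<beta> where ab: "\<alpha> * cnj \<alpha> + \<beta> * cnj \<beta> = 1"
    and zero: "w x x * (\<alpha> * cnj \<alpha> - \<beta> * cnj \<beta>) + \<alpha> * cnj \<beta> * w x y + \<beta> * cnj \<alpha> * w y x = 0"
    by (rule trace_zero_zero_diagonal)
  define x' where "x' = \<alpha> *\<^sub>C x + \<beta> *\<^sub>C y"
  define y' where "y' = (- cnj \<beta>) *\<^sub>C x + cnj \<alpha> *\<^sub>C y"
  have Ax': "A x' = \<alpha> *\<^sub>C A x + \<beta> *\<^sub>C A y" and Ay': "A y' = (- cnj \<beta>) *\<^sub>C A x + cnj \<alpha> *\<^sub>C A y"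
    by (simp_all add: x'_def y'_def cblinfun_apply_add cblinfun_apply_scaleC)
  have H': "(norm x')\<^sup>2 + (norm y')\<^sup>2 = H"
    unfolding x'_def y'_def H_def by (rule norm_unitary_mixing[OF ab])
  have M': "(norm (A x'))\<^sup>2 + (norm (A y'))\<^sup>2 = M"
    unfolding Ax' Ay' M_def by (rule norm_unitary_mixing[OF ab])
  have W': "cinner (A x') x' + cinner (A y') y' = W"
    unfolding Ax' Ay' W_def unfolding x'_def y'_def by (rule cinner_unitary_mixing[OF ab])
  have tr: "w x x + w y y = 0"
  proof -
    have "w x x + w y y = W - W / H * complex_of_real ((norm x)\<^sup>2 + (norm y)\<^sup>2)"
      by (simp add: w_def W_def cinner_self algebra_simps)
    then show ?thesis
      using H by (simp add: H_def[symmetric] del: of_real_add of_real_power)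
  qed
  have "w x' x' = \<alpha> * cnj \<alpha> * w x x + \<beta> * cnj \<beta> * w y y + \<alpha> * cnj \<beta> * w x y + \<beta> * cnj \<alpha> * w y x"
    unfolding w_def Ax' unfolding x'_def
    by (simp add: cinner_add_left cinner_add_right cinner_scaleC_left cinner_scaleC_right algebra_simps
        del: complex_mult_cnj)
  then have wx': "w x' x' = 0"
    using zero tr by (simp add: eq_neg_iff_add_eq_0[symmetric] algebra_simps)
  then have qx: "cinner (A x') x' = W / H * complex_of_real ((norm x')\<^sup>2)"
    by (simp add: w_def cinner_self)
  have "cinner (A y') y' = W - W / H * complex_of_real ((norm x')\<^sup>2)"
    using W' qx by (simp add: algebra_simps)
  also have "\<dots> = W / H * complex_of_real (H - (norm x')\<^sup>2)"
    using H by (simp add: field_simps)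
  finally have qy: "cinner (A y') y' = W / H * complex_of_real ((norm y')\<^sup>2)"
    by (simp add: H'[symmetric])
  have "\<exists>v. v \<noteq> 0 \<and> cinner (A v) v = W / H * complex_of_real ((norm v)\<^sup>2)
      \<and> M * (norm v)\<^sup>2 \<le> (norm (A v))\<^sup>2 * H"
  proof (rule ccontr)
    assume no: "\<not> ?thesis"
    have x: "x' = 0 \<or> (norm (A x'))\<^sup>2 * H < M * (norm x')\<^sup>2"
      using no qx by force
    have y: "y' = 0 \<or> (norm (A y'))\<^sup>2 * H < M * (norm y')\<^sup>2"
      using no qy by force
    have "x' \<noteq> 0 \<or> y' \<noteq> 0"
      using H H' by auto
    then have "((norm (A x'))\<^sup>2 + (norm (A y'))\<^sup>2) * H < M * ((norm x')\<^sup>2 + (norm y')\<^sup>2)"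
      using x y by (auto simp: cblinfun_apply_zero algebra_simps)
    then show False
      unfolding H' M' by simp
  qed
  then obtain v where v: "v \<noteq> 0" "cinner (A v) v = W / H * complex_of_real ((norm v)\<^sup>2)"
      "M * (norm v)\<^sup>2 \<le> (norm (A v))\<^sup>2 * H"
    by blast
  define k where "k = sqrt H / norm v"
  have k2: "k\<^sup>2 = H / (norm v)\<^sup>2"
    using H by (simp add: k_def power_divide)
  define z where "z = complex_of_real k *\<^sub>C v"
  show ?thesis
  proof (rule that[of z])
    show "(norm z)\<^sup>2 = (norm x)\<^sup>2 + (norm y)\<^sup>2"
      using v(1) by (simp add: z_def norm_scaleC power_mult_distrib k2 H_def)
    have "cinner (A z) z = complex_of_real (k\<^sup>2) * cinner (A v) v"
      by (simp add: z_def cblinfun_apply_scaleC cinner_scaleC_left cinner_scaleC_right power2_eq_square)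
    also have "\<dots> = W"
      using v(1) H by (simp add: v(2) k2)
    finally show "cinner (A z) z = cinner (A x) x + cinner (A y) y"
      by (simp add: W_def)
    have "(norm (A z))\<^sup>2 = H / (norm v)\<^sup>2 * (norm (A v))\<^sup>2"
      by (simp add: z_def cblinfun_apply_scaleC norm_scaleC power_mult_distrib k2)
    also have "\<dots> \<ge> M"
      using v(1,3) by (simp add: field_simps)
    finally show "(norm (A z))\<^sup>2 \<ge> (norm (A x))\<^sup>2 + (norm (A y))\<^sup>2"
      by (simp add: M_def)
  qed
qed

definition restricted_range :: "('a::complex_inner \<Rightarrow>\<^sub>B 'a) \<Rightarrow> real \<Rightarrow> complex set"
  where "restricted_range A m = {cinner (A \<xi>) \<xi> | \<xi>. norm \<xi> = 1 \<and> m \<le> (norm (A \<xi>))\<^sup>2}"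

text \<open>Merging \<open>\<surd>s \<xi>\<close> and \<open>\<surd>t \<eta>\<close> gives a unit vector whose value is the convex combination.\<close>
lemma convex_restricted_range: "convex (restricted_range A m)"
proof (rule convexI)
  fix a b :: complex and s t :: real
  assume ab: "a \<in> restricted_range A m" "b \<in> restricted_range A m"
    and st: "0 \<le> s" "0 \<le> t" "s + t = 1"
  obtain \<xi> \<eta> where \<xi>: "a = cinner (A \<xi>) \<xi>" "norm \<xi> = 1" "m \<le> (norm (A \<xi>))\<^sup>2"
    and \<eta>: "b = cinner (A \<eta>) \<eta>" "norm \<eta> = 1" "m \<le> (norm (A \<eta>))\<^sup>2"
    using ab by (auto simp: restricted_range_def)
  obtain z where z: "(norm z)\<^sup>2 = (norm (complex_of_real (sqrt s) *\<^sub>C \<xi>))\<^sup>2 + (norm (complex_of_real (sqrt t) *\<^sub>C \<eta>))\<^sup>2"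
    "cinner (A z) z = cinner (A (complex_of_real (sqrt s) *\<^sub>C \<xi>)) (complex_of_real (sqrt s) *\<^sub>C \<xi>)
       + cinner (A (complex_of_real (sqrt t) *\<^sub>C \<eta>)) (complex_of_real (sqrt t) *\<^sub>C \<eta>)"
    "(norm (A z))\<^sup>2 \<ge> (norm (A (complex_of_real (sqrt s) *\<^sub>C \<xi>)))\<^sup>2 + (norm (A (complex_of_real (sqrt t) *\<^sub>C \<eta>)))\<^sup>2"
    by (rule merge_vectors)
  have scaled: "cinner (A (complex_of_real (sqrt r) *\<^sub>C v)) (complex_of_real (sqrt r) *\<^sub>C v) = r *\<^sub>R cinner (A v) v"
    if "0 \<le> r" for r v
  proof -
    have "cinner (A (complex_of_real (sqrt r) *\<^sub>C v)) (complex_of_real (sqrt r) *\<^sub>C v)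
        = complex_of_real (sqrt r * sqrt r) * cinner (A v) v"
      by (simp add: cblinfun_apply_scaleC cinner_scaleC_left cinner_scaleC_right del: real_sqrt_mult_self)
    then show ?thesis
      using that by (simp add: scaleR_conv_of_real)
  qed
  have "m = s * m + t * m"
    using st(3) by (metis distrib_right mult_1)
  also have "\<dots> \<le> s * (norm (A \<xi>))\<^sup>2 + t * (norm (A \<eta>))\<^sup>2"
    using \<xi>(3) \<eta>(3) st by (intro add_mono mult_left_mono)
  also have "\<dots> \<le> (norm (A z))\<^sup>2"
    using z(3) st by (simp add: cblinfun_apply_scaleC norm_scaleC power_mult_distrib)
  finally have "m \<le> (norm (A z))\<^sup>2" .
  moreover have "norm z = 1"
    using z(1) st \<xi>(2) \<eta>(2) by (simp add: norm_scaleC power_mult_distrib power2_eq_1_iff)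
      (smt (verit) norm_ge_zero)
  moreover have "cinner (A z) z = s *\<^sub>R a + t *\<^sub>R b"
    using z(2) scaled st \<xi>(1) \<eta>(1) by simp
  ultimately show "s *\<^sub>R a + t *\<^sub>R b \<in> restricted_range A m"
    unfolding restricted_range_def by (metis (mono_tags, lifting) mem_Collect_eq)
qed

section \<open>Distance to the scalar operators\<close>

lemma cblinfun_apply_shift:
  "cblinfun_apply (T + \<mu> *\<^sub>C id_cblinfun) x = T x + \<mu> *\<^sub>C x"
  by (simp add: plus_cblinfun.rep_eq scaleC_cblinfun.rep_eq id_cblinfun.rep_eq)

lemma norm_cblinfun_le_unit:
  fixes T :: "'a::complex_inner \<Rightarrow>\<^sub>B 'a"
  assumes "0 \<le> b" and unit: "\<And>\<xi>. norm \<xi> = 1 \<Longrightarrow> norm (T \<xi>) \<le> b"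
  shows "norm T \<le> b"
proof (rule norm_cblinfun_bound[OF assms(1)])
  fix x :: 'a
  show "norm (T x) \<le> b * norm x"
  proof (cases "x = 0")
    case True
    then show ?thesis by (simp add: cblinfun_apply_zero)
  next
    case False
    define \<xi> where "\<xi> = complex_of_real (inverse (norm x)) *\<^sub>C x"
    have "norm (T \<xi>) \<le> b"
      using False by (intro unit) (simp add: \<xi>_def norm_scaleC norm_inverse)
    then show ?thesis
      using False by (simp add: \<xi>_def cblinfun_apply_scaleC norm_scaleC norm_inverse norm_divide field_simps)
  qed
qed

lemma variance_shift:
  fixes T :: "'a::complex_inner \<Rightarrow>\<^sub>B 'a"
  assumes "norm \<xi> = 1"
  shows "(T + \<mu> *\<^sub>C id_cblinfun) \<xi> - cinner ((T + \<mu> *\<^sub>C id_cblinfun) \<xi>) \<xi> *\<^sub>C \<xi>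
       = T \<xi> - cinner (T \<xi>) \<xi> *\<^sub>C \<xi>"
  by (simp add: cblinfun_apply_shift cinner_add_left cinner_scaleC_left cinner_self assms scaleC_add_left)

lemma norm_variance:
  fixes T :: "'a::complex_inner \<Rightarrow>\<^sub>B 'a"
  assumes "norm \<xi> = 1"
  shows "(norm (T \<xi> - cinner (T \<xi>) \<xi> *\<^sub>C \<xi>))\<^sup>2 = (norm (T \<xi>))\<^sup>2 - (cmod (cinner (T \<xi>) \<xi>))\<^sup>2"
  using norm_residual_squared[OF assms] by simp

text \<open>The norm is a Lipschitz function of the scalar, and outside the disc of radius \<open>2 \<parallel>T\<parallel>\<close>
  it is at least its value \<open>\<parallel>T\<parallel>\<close> at 0, so the minimum over the compact disc is global. That growth needs
  a unit vector; on the zero space every operator has norm 0.\<close>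
lemma nearest_scalar_exists:
  fixes T :: "'a::complex_inner \<Rightarrow>\<^sub>B 'a"
  shows "\<exists>\<mu>. \<forall>\<nu>. norm (T + \<mu> *\<^sub>C id_cblinfun) \<le> norm (T + \<nu> *\<^sub>C id_cblinfun)"
proof (cases "\<exists>\<xi>::'a. norm \<xi> = 1")
  case False
  then have "norm S = 0" for S :: "'a \<Rightarrow>\<^sub>B 'a"
    using norm_cblinfun_le_unit[of 0 S] by (auto intro: antisym)
  then show ?thesis
    by (metis order_refl)
next
  case True
  then obtain \<xi> :: 'a where \<xi>: "norm \<xi> = 1" by blast
  define f where "f = (\<lambda>\<mu>. norm (T + \<mu> *\<^sub>C id_cblinfun))"
  have lip: "\<bar>f \<mu> - f \<nu>\<bar> \<le> norm (id_cblinfun :: 'a \<Rightarrow>\<^sub>B 'a) * dist \<mu> \<nu>" for \<mu> \<nu>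
  proof -
    have "T + \<mu> *\<^sub>C id_cblinfun = (T + \<nu> *\<^sub>C id_cblinfun) + (\<mu> - \<nu>) *\<^sub>C id_cblinfun"
      using scaleC_add_left[of "\<mu> - \<nu>" \<nu> "id_cblinfun :: 'a \<Rightarrow>\<^sub>B 'a"] by (simp add: algebra_simps)
    then have "\<bar>f \<mu> - f \<nu>\<bar> \<le> norm ((\<mu> - \<nu>) *\<^sub>C (id_cblinfun :: 'a \<Rightarrow>\<^sub>B 'a))"
      unfolding f_def by (metis add_diff_cancel_left' norm_triangle_ineq3)
    then show ?thesis
      by (simp add: norm_scaleC dist_norm mult.commute)
  qed
  have cont: "continuous_on (cball 0 (2 * norm T)) f"
    by (rule lipschitz_on_continuous_on[where L = "norm (id_cblinfun :: 'a \<Rightarrow>\<^sub>B 'a)"])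
      (auto simp: lipschitz_on_def dist_real_def lip)
  then obtain \<mu> where \<mu>: "\<And>\<nu>. \<nu> \<in> cball 0 (2 * norm T) \<Longrightarrow> f \<mu> \<le> f \<nu>"
    using continuous_attains_inf[of "cball 0 (2 * norm T)" f]
    by (metis centre_in_cball compact_cball empty_iff mult_nonneg_nonneg norm_ge_zero zero_le_numeral)
  show ?thesis
  proof (rule exI[of _ \<mu>], rule allI)
    fix \<nu>
    have "f \<mu> \<le> f \<nu>"
    proof (cases "\<nu> \<in> cball 0 (2 * norm T)")
      case True
      then show ?thesis by (rule \<mu>)
    next
      case False
      have "cmod \<nu> = norm (\<nu> *\<^sub>C \<xi>)"
        by (simp add: norm_scaleC \<xi>)
      also have "\<dots> = norm ((T + \<nu> *\<^sub>C id_cblinfun) \<xi> - T \<xi>)"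
        by (simp add: cblinfun_apply_shift)
      also have "\<dots> \<le> norm ((T + \<nu> *\<^sub>C id_cblinfun) \<xi>) + norm (T \<xi>)"
        by (rule norm_triangle_ineq4)
      also have "\<dots> \<le> f \<nu> + norm T"
        using norm_cblinfun[of "T + \<nu> *\<^sub>C id_cblinfun" \<xi>] norm_cblinfun[of T \<xi>] by (simp add: f_def \<xi>)
      finally have "norm T \<le> f \<nu>"
        using False by (simp add: dist_norm)
      moreover have "f \<mu> \<le> f 0"
        by (rule \<mu>) simp
      moreover have "f 0 = norm T"
        using scaleR_scaleC[of 0 "id_cblinfun :: 'a \<Rightarrow>\<^sub>B 'a"] by (simp add: f_def)
      ultimately show ?thesis by simp
    qed
    then show "norm (T + \<mu> *\<^sub>C id_cblinfun) \<le> norm (T + \<nu> *\<^sub>C id_cblinfun)"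
      by (simp add: f_def)
  qed
qed

text \<open>For unit \<open>\<xi>\<close>, \<open>\<parallel>(A - t a) \<xi>\<parallel>\<^sup>2 = \<parallel>A \<xi>\<parallel>\<^sup>2 - 2 t Re (cnj a (A \<xi> | \<xi>)) + t\<^sup>2 |a|\<^sup>2\<close>. If \<open>a\<close>
  is normal to a line that separates the set from 0, the linear term is a definite gain on the
  vectors counted in the set, and for small \<open>t\<close> the others stay below \<open>\<parallel>A\<parallel>\<close> anyway. So \<open>A\<close> would
  not be minimal.\<close>
lemma zero_in_closure_restricted_range:
  fixes A :: "'a::complex_inner \<Rightarrow>\<^sub>B 'a"
  assumes minimal: "\<And>\<nu>. norm A \<le> norm (A + \<nu> *\<^sub>C id_cblinfun)"
    and m: "0 \<le> m" "m < (norm A)\<^sup>2"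
  shows "0 \<in> closure (restricted_range A m)"
proof (rule ccontr)
  assume "0 \<notin> closure (restricted_range A m)"
  then obtain a b where b: "0 < b" and sep: "\<And>z. z \<in> closure (restricted_range A m) \<Longrightarrow> b < a \<bullet> z"
    using separating_hyperplane_closed_0[of "closure (restricted_range A m)"] convex_restricted_range
    by (metis closed_closure convex_closure)
  define d where "d = norm A"
  \<comment> \<open>the arguments of max bound \<open>\<parallel>(A - t a) \<xi>\<parallel>\<^sup>2\<close> for the unit vectors with \<open>\<parallel>A \<xi>\<parallel>\<^sup>2 \<ge> m\<close> and for the others\<close>
  define K where "K = (\<lambda>t. max (d\<^sup>2 - 2 * t * b + t\<^sup>2 * (cmod a)\<^sup>2) (m + 2 * t * (cmod a * d) + t\<^sup>2 * (cmod a)\<^sup>2))"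
  have "((\<lambda>t. m + 2 * t * (cmod a * d) + t\<^sup>2 * (cmod a)\<^sup>2) \<longlongrightarrow> m + 2 * 0 * (cmod a * d) + 0\<^sup>2 * (cmod a)\<^sup>2) (at_right 0)"
    by (intro tendsto_intros)
  then have "\<forall>\<^sub>F t in at_right 0. m + 2 * t * (cmod a * d) + t\<^sup>2 * (cmod a)\<^sup>2 < d\<^sup>2"
    using m(2) by (intro order_tendstoD) (auto simp: d_def)
  moreover have "((\<lambda>t. t * (cmod a)\<^sup>2) \<longlongrightarrow> 0 * (cmod a)\<^sup>2) (at_right 0)"
    by (intro tendsto_intros)
  then have "\<forall>\<^sub>F t in at_right 0. t * (cmod a)\<^sup>2 < 2 * b"
    using b by (intro order_tendstoD) auto
  moreover have "\<forall>\<^sub>F t::real in at_right 0. 0 < t"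
    by (simp add: eventually_at_right_less)
  ultimately have "\<forall>\<^sub>F t in at_right 0. 0 < t \<and> t * (cmod a)\<^sup>2 < 2 * b
      \<and> m + 2 * t * (cmod a * d) + t\<^sup>2 * (cmod a)\<^sup>2 < d\<^sup>2"
    by eventually_elim simp
  then obtain t where t: "0 < t" "t * (cmod a)\<^sup>2 < 2 * b" "m + 2 * t * (cmod a * d) + t\<^sup>2 * (cmod a)\<^sup>2 < d\<^sup>2"
    using eventually_happens'[OF trivial_limit_at_right_real] by blast
  have "t * (t * (cmod a)\<^sup>2) < t * (2 * b)"
    using t(1,2) by (rule mult_strict_left_mono[rotated])
  then have K_less: "K t < d\<^sup>2"
    using t(3) by (simp add: K_def power2_eq_square algebra_simps)
  have K_nonneg: "0 \<le> K t"
    using t(1) m(1) by (simp add: K_def le_max_iff_disj d_def)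
  define B where "B = A + (- complex_of_real t * a) *\<^sub>C id_cblinfun"
  have "norm (B \<xi>) \<le> sqrt (K t)" if \<xi>: "norm \<xi> = 1" for \<xi>
  proof -
    have "(norm (B \<xi>))\<^sup>2 = (norm (A \<xi>))\<^sup>2 + 2 * Re (cinner (A \<xi>) ((- complex_of_real t * a) *\<^sub>C \<xi>))
        + (norm ((- complex_of_real t * a) *\<^sub>C \<xi>))\<^sup>2"
      unfolding B_def cblinfun_apply_shift by (rule norm_add_squared)
    also have "\<dots> = (norm (A \<xi>))\<^sup>2 - 2 * t * (a \<bullet> cinner (A \<xi>) \<xi>) + t\<^sup>2 * (cmod a)\<^sup>2"
      by (simp add: cinner_scaleC_right norm_scaleC \<xi> norm_mult power_mult_distrib inner_complex_def algebra_simps)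
    also have "\<dots> \<le> K t"
    proof (cases "m \<le> (norm (A \<xi>))\<^sup>2")
      case True
      then have "cinner (A \<xi>) \<xi> \<in> restricted_range A m"
        using \<xi> by (auto simp: restricted_range_def)
      then have "b < a \<bullet> cinner (A \<xi>) \<xi>"
        using closure_subset sep by blast
      then have "t * b \<le> t * (a \<bullet> cinner (A \<xi>) \<xi>)"
        using t(1) by simp
      moreover have "(norm (A \<xi>))\<^sup>2 \<le> d\<^sup>2"
        using norm_cblinfun[of A \<xi>] by (simp add: \<xi> d_def power_mono)
      ultimately show ?thesis
        by (simp add: K_def le_max_iff_disj)
    next
      case False
      have "\<bar>a \<bullet> cinner (A \<xi>) \<xi>\<bar> \<le> cmod a * cmod (cinner (A \<xi>) \<xi>)"
        by (rule Cauchy_Schwarz_ineq2)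
      also have "\<dots> \<le> cmod a * d"
        using cmod_cinner_le_norm[OF \<xi>, of "A \<xi>"] norm_cblinfun[of A \<xi>]
        by (intro mult_left_mono) (simp_all add: \<xi> d_def)
      finally have "- (t * (a \<bullet> cinner (A \<xi>) \<xi>)) \<le> t * (cmod a * d)"
        using t(1) by (metis abs_le_D2 mult_le_cancel_left_pos mult_minus_right)
      then show ?thesis
        using False by (simp add: K_def le_max_iff_disj)
    qed
    finally show ?thesis
      by (rule real_le_rsqrt)
  qed
  then have "norm B \<le> sqrt (K t)"
    using K_nonneg by (intro norm_cblinfun_le_unit) auto
  also have "\<dots> < d"
    using K_less by (simp add: d_def real_less_lsqrt)
  finally show False
    using minimal[of "- complex_of_real t * a"] by (simp add: B_def d_def)
qed

text \<open>Were the minimal norm above \<open>s\<close>, a level \<open>m\<close> strictly between the squares would leave a margin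
  \<open>m - s\<^sup>2\<close>, and a vector with \<open>\<parallel>A \<xi>\<parallel>\<^sup>2 \<ge> m\<close> and \<open>|(A \<xi> | \<xi>)|\<^sup>2\<close> below the margin would violate
  the bound.\<close>
lemma distance_to_scalars_le:
  fixes T :: "'a::complex_inner \<Rightarrow>\<^sub>B 'a"
  assumes s: "0 \<le> s" and bound: "\<And>\<xi>. norm \<xi> = 1 \<Longrightarrow> norm (T \<xi> - cinner (T \<xi>) \<xi> *\<^sub>C \<xi>) \<le> s"
  shows "\<exists>\<mu>. norm (T + \<mu> *\<^sub>C id_cblinfun) \<le> s"
proof -
  obtain \<mu> where \<mu>: "\<And>\<nu>. norm (T + \<mu> *\<^sub>C id_cblinfun) \<le> norm (T + \<nu> *\<^sub>C id_cblinfun)"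
    using nearest_scalar_exists[of T] by blast
  define A where "A = T + \<mu> *\<^sub>C id_cblinfun"
  have minimal: "norm A \<le> norm (A + \<nu> *\<^sub>C id_cblinfun)" for \<nu>
    using \<mu>[of "\<mu> + \<nu>"] by (simp add: A_def scaleC_add_left add.assoc)
  have "norm A \<le> s"
  proof (rule ccontr)
    assume "\<not> norm A \<le> s"
    then have "s\<^sup>2 < (norm A)\<^sup>2"
      using s by (intro power_strict_mono) auto
    then obtain m where m: "s\<^sup>2 < m" "m < (norm A)\<^sup>2"
      using dense by blast
    have m0: "0 \<le> m"
      using m(1) zero_le_power2[of s] by linarith
    have "0 < sqrt (m - s\<^sup>2)"
      using m(1) by simp
    then obtain z where "z \<in> restricted_range A m" and z: "dist z 0 < sqrt (m - s\<^sup>2)"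
      using zero_in_closure_restricted_range[OF minimal m0 m(2)] by (meson closure_approachable)
    then obtain \<xi> where \<xi>: "norm \<xi> = 1" "m \<le> (norm (A \<xi>))\<^sup>2" "z = cinner (A \<xi>) \<xi>"
      by (auto simp: restricted_range_def)
    have "(cmod z)\<^sup>2 < m - s\<^sup>2"
      using z m(1) power_strict_mono[of "cmod z" "sqrt (m - s\<^sup>2)" 2] by simp
    then have "s\<^sup>2 < (norm (A \<xi> - cinner (A \<xi>) \<xi> *\<^sub>C \<xi>))\<^sup>2"
      using \<xi>(2) by (simp add: norm_variance[OF \<xi>(1)] \<xi>(3))
    moreover have "norm (A \<xi> - cinner (A \<xi>) \<xi> *\<^sub>C \<xi>) \<le> s"
      unfolding A_def variance_shift[OF \<xi>(1)] by (rule bound[OF \<xi>(1)])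
    ultimately show False
      by (meson norm_ge_zero not_less power_mono)
  qed
  then show ?thesis
    unfolding A_def by blast
qed

section \<open>The norm of an inner derivation\<close>

lemma norm_reflect:
  fixes z \<xi> :: "'a::complex_inner"
  assumes "norm \<xi> = 1"
  shows "norm (z - (2 * cinner z \<xi>) *\<^sub>C \<xi>) = norm z"
proof -
  have "cinner z \<xi> - 2 * cinner z \<xi> = - cinner z \<xi>"
    by simp
  then have "(norm (z - (2 * cinner z \<xi>) *\<^sub>C \<xi>))\<^sup>2 = (norm z)\<^sup>2"
    using norm_residual_squared[OF assms, of z "2 * cinner z \<xi>"] by simp
  then show ?thesis
    by (simp add: power2_eq_iff_nonneg)
qed

lemma reflection_operator_exists:
  fixes \<xi> :: "'a::complex_inner"
  assumes \<xi>: "norm \<xi> = 1"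
  shows "\<exists>S :: 'a \<Rightarrow>\<^sub>B 'a. norm S \<le> 1 \<and> (\<forall>z. cblinfun_apply S z = z - (2 * cinner z \<xi>) *\<^sub>C \<xi>)"
proof -
  define f where "f = (\<lambda>z. z - (2 * cinner z \<xi>) *\<^sub>C \<xi>)"
  have add: "f (x + y) = f x + f y" for x y
    by (simp add: f_def cinner_add_left distrib_left scaleC_add_left)
  have scale: "f (c *\<^sub>C x) = c *\<^sub>C f x" for c x
    by (simp add: f_def cinner_scaleC_left scaleC_diff_right scaleC_scaleC mult.left_commute)
  have norm_f: "norm (f x) = norm x" for x
    by (simp add: f_def norm_reflect[OF \<xi>])
  have "bounded_linear f"
    by (rule bounded_linear_intro[where K = 1]) (simp_all add: add scale scaleR_scaleC norm_f)
  then have app: "cblinfun_apply (CBlinfun f) = f"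
    using scale by (simp add: CBlinfun_inverse)
  show ?thesis
  proof (intro exI conjI allI)
    show "cblinfun_apply (CBlinfun f) z = z - (2 * cinner z \<xi>) *\<^sub>C \<xi>" for z
      unfolding app by (simp add: f_def)
    show "norm (CBlinfun f) \<le> 1"
      by (rule norm_cblinfun_bound) (simp_all add: app norm_f)
  qed
qed

lemma inner_derivation_apply:
  "cblinfun_apply (cblinfun_apply (inner_derivation T) S) x = T (S x) - S (T x)"
  by (simp add: inner_derivation.rep_eq minus_cblinfun.rep_eq cblinfun_compose.rep_eq)

text \<open>The reflection \<open>S\<close> has \<open>S \<xi> = - \<xi>\<close>, hence
  \<open>T S \<xi> - S T \<xi> = - T \<xi> - (T \<xi> - 2 (T \<xi> | \<xi>) \<xi>)\<close>, which is twice the residual up to sign.\<close>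
lemma norm_inner_derivation_ge:
  fixes T :: "'a::complex_inner \<Rightarrow>\<^sub>B 'a"
  assumes \<xi>: "norm \<xi> = 1"
  shows "2 * norm (T \<xi> - cinner (T \<xi>) \<xi> *\<^sub>C \<xi>) \<le> norm (inner_derivation T)"
proof -
  obtain S :: "'a \<Rightarrow>\<^sub>B 'a" where S: "\<And>z. S z = z - (2 * cinner z \<xi>) *\<^sub>C \<xi>" and normS: "norm S \<le> 1"
    using reflection_operator_exists[OF \<xi>] by blast
  define e where "e = T \<xi> - cinner (T \<xi>) \<xi> *\<^sub>C \<xi>"
  have two: "2 *\<^sub>C v = v + v" for v :: 'a
    using scaleC_add_left[of 1 1 v] by (simp add: scaleC_one)
  have "S \<xi> = (-1) *\<^sub>C \<xi>"
    by (simp add: S cinner_self \<xi> two scaleC_minus1)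
  then have "T (S \<xi>) = - T \<xi>"
    using cblinfun_apply_scaleC[of T "-1" \<xi>] by (simp add: scaleC_minus1)
  moreover have "S (T \<xi>) = T \<xi> - (cinner (T \<xi>) \<xi> *\<^sub>C \<xi> + cinner (T \<xi>) \<xi> *\<^sub>C \<xi>)"
    by (simp add: S scaleC_scaleC[symmetric] two)
  ultimately have "inner_derivation T S \<xi> = - (2 *\<^sub>C e)"
    by (simp add: inner_derivation_apply e_def two)
  then have "2 * norm e = norm (inner_derivation T S \<xi>)"
    by (simp add: norm_scaleC)
  also have "\<dots> \<le> norm (inner_derivation T S)"
    using norm_cblinfun[of "inner_derivation T S" \<xi>] by (simp add: \<xi>)
  also have "\<dots> \<le> norm (inner_derivation T) * norm S"
    by (rule norm_cblinfun)
  also have "\<dots> \<le> norm (inner_derivation T)"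
    using normS by (simp add: mult_left_le)
  finally show ?thesis
    by (simp add: e_def)
qed

text \<open>Scalar operators commute with every \<open>S\<close>, so \<open>T\<close> and \<open>T + \<mu> I\<close> induce the same derivation.\<close>
lemma norm_inner_derivation_le:
  fixes T :: "'a::complex_inner \<Rightarrow>\<^sub>B 'a"
  shows "norm (inner_derivation T) \<le> 2 * norm (T + \<mu> *\<^sub>C id_cblinfun)"
proof (rule norm_cblinfun_bound)
  fix S :: "'a \<Rightarrow>\<^sub>B 'a"
  define A where "A = T + \<mu> *\<^sub>C id_cblinfun"
  have "inner_derivation T S = (A o\<^sub>C S) - (S o\<^sub>C A)"
    by (rule cblinfun_eqI)
      (simp add: inner_derivation_apply A_def minus_cblinfun.rep_eq cblinfun_compose.rep_eq
        cblinfun_apply_shift cblinfun_apply_add cblinfun_apply_scaleC)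
  then have "norm (inner_derivation T S) \<le> norm (A o\<^sub>C S) + norm (S o\<^sub>C A)"
    by (simp add: norm_triangle_ineq4)
  also have "\<dots> \<le> 2 * norm A * norm S"
    using norm_cblinfun_compose[of A S] norm_cblinfun_compose[of S A] by (simp add: algebra_simps)
  finally show "norm (inner_derivation T S) \<le> 2 * norm (T + \<mu> *\<^sub>C id_cblinfun) * norm S"
    by (simp add: A_def)
qed simp

section \<open>Approximate parallelism to the identity\<close>

theorem corollary3p11:
  fixes T :: "'a::chilbert_space \<Rightarrow>\<^sub>B 'a" and \<epsilon> :: real
  assumes "0 \<le> \<epsilon>" and "\<epsilon> < 1"
  shows
    "(approx_parallel \<epsilon> T id_cblinfun
        \<longleftrightarrow> (SUP \<xi>\<in>{\<xi>. norm \<xi> = 1}. ereal (norm (T \<xi> - cinner (T \<xi>) \<xi> *\<^sub>C \<xi>))) \<le> ereal (\<epsilon> * norm T))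
     \<and> ((SUP \<xi>\<in>{\<xi>. norm \<xi> = 1}. ereal (norm (T \<xi> - cinner (T \<xi>) \<xi> *\<^sub>C \<xi>))) \<le> ereal (\<epsilon> * norm T)
        \<longleftrightarrow> (SUP \<xi>\<in>{\<xi>. norm \<xi> = 1}. ereal ((norm (T \<xi>))\<^sup>2 - (cmod (cinner (T \<xi>) \<xi>))\<^sup>2))
              \<le> ereal (\<epsilon>\<^sup>2 * (norm T)\<^sup>2))
     \<and> ((SUP \<xi>\<in>{\<xi>. norm \<xi> = 1}. ereal ((norm (T \<xi>))\<^sup>2 - (cmod (cinner (T \<xi>) \<xi>))\<^sup>2))
              \<le> ereal (\<epsilon>\<^sup>2 * (norm T)\<^sup>2)
        \<longleftrightarrow> norm (inner_derivation T) \<le> 2 * \<epsilon> * norm T)"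
proof -
  define b where "b = \<epsilon> * norm T"
  have b: "0 \<le> b"
    using assms(1) by (simp add: b_def)
  define small where
    "small \<longleftrightarrow> (\<forall>\<xi>::'a. norm \<xi> = 1 \<longrightarrow> norm (T \<xi> - cinner (T \<xi>) \<xi> *\<^sub>C \<xi>) \<le> b)"
  define near where "near \<longleftrightarrow> (\<exists>\<mu>. norm (T + \<mu> *\<^sub>C id_cblinfun) \<le> b)"
  have i: "approx_parallel \<epsilon> T id_cblinfun \<longleftrightarrow> near"
  proof
    obtain \<mu> where \<mu>: "\<And>\<nu>. norm (T + \<mu> *\<^sub>C id_cblinfun) \<le> norm (T + \<nu> *\<^sub>C id_cblinfun)"
      using nearest_scalar_exists[of T] by blast
    have "norm (T + \<mu> *\<^sub>C id_cblinfun) \<le> (INF \<nu>. norm (T + \<nu> *\<^sub>C id_cblinfun))"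
      by (rule cINF_greatest) (simp_all add: \<mu>)
    then show "approx_parallel \<epsilon> T id_cblinfun \<Longrightarrow> near"
      unfolding approx_parallel_def near_def b_def by (meson order_trans)
  next
    have bdd: "bdd_below (range (\<lambda>\<nu>. norm (T + \<nu> *\<^sub>C id_cblinfun)))"
      by (rule bdd_belowI[of _ 0]) auto
    assume near
    then show "approx_parallel \<epsilon> T id_cblinfun"
      unfolding approx_parallel_def near_def b_def using cINF_lower[OF bdd] by (meson UNIV_I order_trans)
  qed
  have ii: "(SUP \<xi>\<in>{\<xi>. norm \<xi> = 1}. ereal (norm (T \<xi> - cinner (T \<xi>) \<xi> *\<^sub>C \<xi>))) \<le> ereal (\<epsilon> * norm T)
      \<longleftrightarrow> small"
    by (simp add: SUP_le_iff small_def b_def)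
  have "norm (T \<xi> - cinner (T \<xi>) \<xi> *\<^sub>C \<xi>) \<le> b \<longleftrightarrow> (norm (T \<xi>))\<^sup>2 - (cmod (cinner (T \<xi>) \<xi>))\<^sup>2 \<le> b\<^sup>2"
    if "norm \<xi> = 1" for \<xi>
    using b abs_le_square_iff[of "norm (T \<xi> - cinner (T \<xi>) \<xi> *\<^sub>C \<xi>)" b] by (simp add: norm_variance[OF that])
  then have iii: "(SUP \<xi>\<in>{\<xi>. norm \<xi> = 1}. ereal ((norm (T \<xi>))\<^sup>2 - (cmod (cinner (T \<xi>) \<xi>))\<^sup>2))
      \<le> ereal (\<epsilon>\<^sup>2 * (norm T)\<^sup>2) \<longleftrightarrow> small"
    by (simp add: SUP_le_iff small_def b_def power_mult_distrib)
  have near_if: near if small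
    using distance_to_scalars_le[OF b] that by (auto simp: near_def small_def)
  have der_if: "norm (inner_derivation T) \<le> 2 * b" if near
    using that norm_inner_derivation_le[of T] unfolding near_def
    by (meson mult_left_mono order_trans zero_le_numeral)
  have small if "norm (inner_derivation T) \<le> 2 * b"
    using that norm_inner_derivation_ge[of _ T] unfolding small_def by fastforce
  then have iv: "norm (inner_derivation T) \<le> 2 * \<epsilon> * norm T \<longleftrightarrow> small"
    using near_if der_if by (auto simp: b_def mult.assoc)
  have "near \<longleftrightarrow> small"
    using near_if der_if iv by (auto simp: b_def mult.assoc)
  then show ?thesis
    unfolding i ii iii iv by simp
qed

end
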